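(* Let $\mathcal{R}$ be a commutative ring with unity, $k\in\mathbb{N}$, and let $\mathcal{I}_0,\mathcal{I}_1,\ldots,\mathcal{I}_k$ be mutually co-maximal ideals of $\mathcal{R}$ such that either $\mathcal{I}=\prod_{i=0}^{k}\mathcal{I}_i$ satisfies the unital set condition (USC) or $\mathcal{I}=\mathcal{R}$. Let $m^i_j\in\mathbb{N}$ for $0\le i,j\le k$. Then the map \[SL_{k+1}(\mathcal{R})\longrightarrow\prod_{i=0}^{k}\mathbb{PF}^{k,(m^i_0,m^i_1,\ldots,m^i_k)}_{\mathcal{I}_i},\qquad [a_{i,j}]_{0\le i,j\le k}\mapsto\big([a_{0,0}:\cdots:a_{0,k}],[a_{1,0}:\cdots:a_{1,k}],\ldots,[a_{k,0}:\cdots:a_{k,k}]\big)\] is surjective.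
   Context: For a commutative ring $\mathcal{R}$ with unity and $k\in\mathbb{N}$, let $\mathcal{GCD}_{k+1}(\mathcal{R})=\{(a_0,\ldots,a_k)\in\mathcal{R}^{k+1}\mid\sum_i\langle a_i\rangle=\mathcal{R}\}$. For an ideal $\mathcal{J}\subsetneq\mathcal{R}$ and $m_0,\ldots,m_k\in\mathbb{N}$, $(a_0,\ldots,a_k)\sim(b_0,\ldots,b_k)$ if there is $\lambda\in\mathcal{R}$ with image a unit in $\mathcal{R}/\mathcal{J}$ and $a_i\equiv\lambda^{m_i}b_i\bmod\mathcal{J}$ for all $i$; $\mathbb{PF}^{k,(m_0,\ldots,m_k)}_{\mathcal{J}}=\mathcal{GCD}_{k+1}(\mathcal{R})/\sim$, with classes written $[a_0:\cdots:a_k]$. If $\mathcal{J}=\mathcal{R}$ all elements are related and the space is a singleton. (Note rows of a matrix in $SL_{k+1}(\mathcal{R})$ lie in $\mathcal{GCD}_{k+1}(\mathcal{R})$.) A finite subset of $\mathcal{R}$ is unital if it generates the unit ideal. An ideal $\mathcal{J}\subsetneq\mathcal{R}$ satisfies the USC if for every $n\ge2$ and every unital set $\{a_1,\ldots,a_n\}$ there exists $b\in\langle a_2,\ldots,a_n\rangle$ with $a_1+b$ a unit modulo $\mathcal{J}$. *)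

theory Defs
  imports
    "HOL-Algebra.Ideal_Product"
    "HOL-Algebra.QuotRing"
    "HOL-Combinatorics.Permutations"
begin

text \<open>
  Tuples $(a_0,\ldots,a_k)$ and $(k+1)\times(k+1)$ matrices $[a_{i,j}]_{0\le i,j\le k}$ are
  extensional functions on \<^term>\<open>{..k}\<close>, so that equality of functions is equality of
  tuples and matrices; \<^term>\<open>A i\<close> is the row of index \<^term>\<open>i\<close>.
\<close>

definition unit_mod :: "('a, 'b) ring_scheme \<Rightarrow> 'a set \<Rightarrow> 'a \<Rightarrow> bool" where
  "unit_mod R J x \<longleftrightarrow> J +>\<^bsub>R\<^esub> x \<in> Units (R Quot J)"

text \<open>
  The sum of the principal ideals is taken in the semiring of ideals
  \<^term>\<open>ideals_set R\<close>, whose addition is the sum of ideals.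
\<close>

definition GCD_tuples :: "('a, 'b) ring_scheme \<Rightarrow> nat \<Rightarrow> (nat \<Rightarrow> 'a) set" where
  "GCD_tuples R k =
     {a \<in> {..k} \<rightarrow>\<^sub>E carrier R.
        (\<Oplus>\<^bsub>ideals_set R\<^esub>i\<in>{..k}. PIdl\<^bsub>R\<^esub> (a i)) = carrier R}"

definition PF_rel ::
  "('a, 'b) ring_scheme \<Rightarrow> nat \<Rightarrow> (nat \<Rightarrow> nat) \<Rightarrow> 'a set
     \<Rightarrow> ((nat \<Rightarrow> 'a) \<times> (nat \<Rightarrow> 'a)) set" where
  "PF_rel R k m J =
     {(a, b). a \<in> GCD_tuples R k \<and> b \<in> GCD_tuples R k \<and>
        (J = carrier R \<or>
         (\<exists>l\<in>carrier R. unit_mod R J l \<and>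
            (\<forall>i\<le>k. a i \<ominus>\<^bsub>R\<^esub> (l [^]\<^bsub>R\<^esub> m i) \<otimes>\<^bsub>R\<^esub> b i \<in> J)))}"

definition PF_class ::
  "('a, 'b) ring_scheme \<Rightarrow> nat \<Rightarrow> (nat \<Rightarrow> nat) \<Rightarrow> 'a set \<Rightarrow> (nat \<Rightarrow> 'a) \<Rightarrow> (nat \<Rightarrow> 'a) set" where
  "PF_class R k m J a = PF_rel R k m J `` {a}"

definition PF_space ::
  "('a, 'b) ring_scheme \<Rightarrow> nat \<Rightarrow> (nat \<Rightarrow> nat) \<Rightarrow> 'a set \<Rightarrow> (nat \<Rightarrow> 'a) set set" where
  "PF_space R k m J = GCD_tuples R k // PF_rel R k m J"

definition unital_set :: "('a, 'b) ring_scheme \<Rightarrow> 'a set \<Rightarrow> bool" where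
  "unital_set R S \<longleftrightarrow> finite S \<and> S \<subseteq> carrier R \<and> Idl\<^bsub>R\<^esub> S = carrier R"

definition USC :: "('a, 'b) ring_scheme \<Rightarrow> 'a set \<Rightarrow> bool" where
  "USC R J \<longleftrightarrow> ideal J R \<and> J \<noteq> carrier R \<and>
     (\<forall>n\<ge>2. \<forall>a :: nat \<Rightarrow> 'a. unital_set R (a ` {1..n}) \<longrightarrow>
        (\<exists>b \<in> Idl\<^bsub>R\<^esub> (a ` {2..n}). unit_mod R J (a 1 \<oplus>\<^bsub>R\<^esub> b)))"

text \<open>Leibniz formula, over a ring given by its carrier; the index set is \<^term>\<open>{..k}\<close>.\<close>

definition ring_det :: "('a, 'b) ring_scheme \<Rightarrow> nat \<Rightarrow> (nat \<Rightarrow> nat \<Rightarrow> 'a) \<Rightarrow> 'a" where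
  "ring_det R k A =
     (\<Oplus>\<^bsub>R\<^esub>p\<in>{p. p permutes {..k}}.
        (if evenperm p then (\<Otimes>\<^bsub>R\<^esub>i\<in>{..k}. A i (p i))
         else \<ominus>\<^bsub>R\<^esub> (\<Otimes>\<^bsub>R\<^esub>i\<in>{..k}. A i (p i))))"

text \<open>The subscript convention is by the last index: \<^term>\<open>SL_mats R k\<close> is $SL_{k+1}(R)$.\<close>

definition SL_mats :: "('a, 'b) ring_scheme \<Rightarrow> nat \<Rightarrow> (nat \<Rightarrow> nat \<Rightarrow> 'a) set" where
  "SL_mats R k =
     {A \<in> {..k} \<rightarrow>\<^sub>E ({..k} \<rightarrow>\<^sub>E carrier R). ring_det R k A = \<one>\<^bsub>R\<^esub>}"

definition row_map ::
  "('a, 'b) ring_scheme \<Rightarrow> nat \<Rightarrow> (nat \<Rightarrow> nat \<Rightarrow> nat) \<Rightarrow> (nat \<Rightarrow> 'a set)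
     \<Rightarrow> (nat \<Rightarrow> nat \<Rightarrow> 'a) \<Rightarrow> nat \<Rightarrow> (nat \<Rightarrow> 'a) set" where
  "row_map R k m I A = (\<lambda>i\<in>{..k}. PF_class R k (m i) (I i) (A i))"

end

theory Submission
  imports Defs
begin

text \<open>
  Every scalar \<open>\<lambda>\<close> can be taken to be 1: given unimodular rows $b_0,\ldots,b_k$ there is a matrix
  of determinant 1 whose row $i$ is congruent to $b_i$ modulo $I_i$. By the Chinese remainder
  theorem choose $c_t$ congruent to 1 modulo $I_t$ and lying in every other $I_i$. Adding $c_t r$
  times one column to another then acts on row $t$ modulo $I_t$ as the elementary operation with
  coefficient $r$, and leaves each row $i \neq t$ unchanged modulo $I_i$. So, starting from the
  identity matrix, the rows can be treated one after the other, and it suffices to turn the unit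
  vector $e_t$ into $b_t$ modulo $I_t$ by elementary operations. For some $s \neq t$, the USC
  provides $z$ in the ideal generated by the entries of $b_t$ other than entry $s$, such that adding
  $z$ to entry $s$ makes it a unit modulo $I_t$. From $e_t$ fill in all the entries except $t$, with
  this unit at $s$; use the unit to correct entry $t$; then remove $z$ from entry $s$.
\<close>

context cring
begin

section \<open>Determinants from the Leibniz formula: column operations and the ideal of a
  row\<close>

lemma permuted_entries_closed:
  assumes "A \<in> {..k} \<rightarrow> ({..k} \<rightarrow> carrier R)" "s permutes {..k}"
  shows "(\<lambda>i. A i (s i)) \<in> {..k} \<rightarrow> carrier R"
proof (rule funcsetI)
  fix i assume i: "i \<in> {..k}"
  then have "s i \<in> {..k}" using assms(2) by (simp only: permutes_in_image)
  with i assms(1) show "A i (s i) \<in> carrier R" by auto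
qed

text \<open>With the sign as a factor, linearity in a column follows from distributivity, uniformly
  in the parity of the permutation.\<close>

lemma ring_det_signed:
  assumes "A \<in> {..k} \<rightarrow> ({..k} \<rightarrow> carrier R)"
  shows "ring_det R k A =
    (\<Oplus>p\<in>{p. p permutes {..k}}. (if evenperm p then \<one> else \<ominus> \<one>) \<otimes> (\<Otimes>i\<in>{..k}. A i (p i)))"
  unfolding ring_det_def
proof (intro finsum_cong' refl funcsetI)
  fix p assume "p \<in> {p. p permutes {..k}}"
  then have "(\<lambda>i. A i (p i)) \<in> {..k} \<rightarrow> carrier R"
    using assms by (simp add: permuted_entries_closed)
  then have c: "(\<Otimes>i\<in>{..k}. A i (p i)) \<in> carrier R"
    by (rule finprod_closed)
  then show "(if evenperm p then \<one> else \<ominus> \<one>) \<otimes> (\<Otimes>i\<in>{..k}. A i (p i)) \<in> carrier R"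
    by auto
  show "(if evenperm p then \<Otimes>i\<in>{..k}. A i (p i) else \<ominus> (\<Otimes>i\<in>{..k}. A i (p i))) =
      (if evenperm p then \<one> else \<ominus> \<one>) \<otimes> (\<Otimes>i\<in>{..k}. A i (p i))"
    using c by (simp add: l_minus)
qed

text \<open>Composition with the transposition of \<open>p\<close> and \<open>q\<close> pairs even
  permutations with odd ones. Paired products agree, so the signed terms cancel pair by pair. This
  argument is valid in characteristic 2 as well, where antisymmetry alone would not give
  zero.\<close>

lemma ring_det_equal_columns:
  assumes A: "A \<in> {..k} \<rightarrow> ({..k} \<rightarrow> carrier R)"
    and pq: "p \<le> k" "q \<le> k" "p \<noteq> q" "\<And>i. i \<le> k \<Longrightarrow> A i p = A i q"
  shows "ring_det R k A = \<zero>"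
proof -
  let ?P = "{s. s permutes {..k}}" and ?t = "transpose p q"
  let ?E = "{s \<in> ?P. evenperm s}" and ?O = "{s \<in> ?P. \<not> evenperm s}"
  define f where "f s = (\<Otimes>i\<in>{..k}. A i (s i))" for s
  have fin: "finite ?P" by (simp add: finite_permutations)
  have cl: "f s \<in> carrier R" if "s \<in> ?P" for s
    unfolding f_def using A that by (simp add: permuted_entries_closed)
  have tp: "?t permutes {..k}" using pq by (simp add: permutes_swap_id)
  have par: "evenperm (?t \<circ> s) \<longleftrightarrow> \<not> evenperm s" if "s \<in> ?P" for s
    using that pq by (subst evenperm_comp)
      (auto simp: evenperm_swap permutation_swap_id intro: permutes_imp_permutation[of "{..k}"])
  have comp: "?t \<circ> s \<in> ?P" if "s \<in> ?P" for s
    using that tp by (simp add: permutes_compose)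
  \<comment> \<open>The composition is an involution that flips parity, hence a bijection from
    \<open>?E\<close> onto \<open>?O\<close>.\<close>
  have img: "(\<circ>) ?t ` ?E = ?O"
  proof
    show "(\<circ>) ?t ` ?E \<subseteq> ?O" using par comp by blast
    show "?O \<subseteq> (\<circ>) ?t ` ?E"
    proof
      fix s assume "s \<in> ?O"
      then have "?t \<circ> s \<in> ?E" using par comp by auto
      moreover have "s = ?t \<circ> (?t \<circ> s)" by (simp add: fun_eq_iff)
      ultimately show "s \<in> (\<circ>) ?t ` ?E" by blast
    qed
  qed
  have inj: "inj_on ((\<circ>) ?t) ?E"
    by (rule inj_on_inverseI[where g = "(\<circ>) ?t"]) (simp add: fun_eq_iff)
  have same: "f (?t \<circ> s) = f s" if "s \<in> ?P" for s
    unfolding f_def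
  proof (rule finprod_cong'[OF refl])
    show "(\<lambda>i. A i (s i)) \<in> {..k} \<rightarrow> carrier R"
      using A that by (simp add: permuted_entries_closed)
    show "A i ((?t \<circ> s) i) = A i (s i)" if "i \<in> {..k}" for i
      using that pq by (auto simp: transpose_def)
  qed
  have "ring_det R k A = (\<Oplus>s\<in>?E \<union> ?O. if evenperm s then f s else \<ominus> f s)"
    unfolding ring_det_def f_def by (intro arg_cong[where f = "finsum R _"]) auto
  also have "\<dots> = (\<Oplus>s\<in>?E. if evenperm s then f s else \<ominus> f s) \<oplus>
      (\<Oplus>s\<in>?O. if evenperm s then f s else \<ominus> f s)"
    using fin cl by (intro finsum_Un_disjoint) auto
  also have "(\<Oplus>s\<in>?E. if evenperm s then f s else \<ominus> f s) = (\<Oplus>s\<in>?E. f s)"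
    using cl by (intro finsum_cong') auto
  also have "(\<Oplus>s\<in>?O. if evenperm s then f s else \<ominus> f s) = (\<Oplus>s\<in>?E. \<ominus> f s)"
  proof -
    have "(\<Oplus>s\<in>?O. if evenperm s then f s else \<ominus> f s) = (\<Oplus>s\<in>?O. \<ominus> f s)"
      using cl by (intro finsum_cong') auto
    \<comment> \<open>The sum over odd permutations is reindexed by the even ones, so that both sums
      range over \<open>?E\<close>.\<close>
    also have "\<dots> = (\<Oplus>s\<in>?E. \<ominus> f (?t \<circ> s))"
      unfolding img[symmetric] using cl comp inj by (intro finsum_reindex) auto
    also have "\<dots> = (\<Oplus>s\<in>?E. \<ominus> f s)"
      using cl same by (intro finsum_cong') auto
    finally show ?thesis .
  qed
  also have "(\<Oplus>s\<in>?E. f s) \<oplus> (\<Oplus>s\<in>?E. \<ominus> f s) = (\<Oplus>s\<in>?E. f s \<oplus> \<ominus> f s)"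
    using cl by (intro finsum_addf[symmetric]) auto
  also have "\<dots> = (\<Oplus>s\<in>?E. \<zero>)"
    using cl by (intro finsum_cong') (auto simp: r_neg)
  finally show ?thesis by simp
qed

text \<open>Linearity of a product in the factor of index \<open>a\<close>. In a Leibniz term,
  \<open>a\<close> will be the row whose entry comes from the modified column.\<close>

lemma finprod_update_add:
  assumes S: "finite S" "a \<in> S" and f: "f \<in> S \<rightarrow> carrier R" and x: "x \<in> carrier R"
    and r: "r \<in> carrier R"
  shows "finprod R (f(a := f a \<oplus> r \<otimes> x)) S = finprod R f S \<oplus> r \<otimes> finprod R (f(a := x)) S"
proof -
  have eq: "finprod R (f(a := y)) S = y \<otimes> finprod R f (S - {a})" if "y \<in> carrier R" for y
  proof -
    have "finprod R (f(a := y)) (insert a (S - {a}))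
        = (f(a := y)) a \<otimes> finprod R (f(a := y)) (S - {a})"
      using S f that by (intro finprod_insert) auto
    also have "finprod R (f(a := y)) (S - {a}) = finprod R f (S - {a})"
      using f by (intro finprod_cong') auto
    finally show ?thesis using S by (simp add: insert_absorb del: fun_upd_apply) simp
  qed
  have "f a \<in> carrier R" and c: "finprod R f (S - {a}) \<in> carrier R"
    using S f by (auto intro!: finprod_closed)
  then show ?thesis
    using eq[of "f a \<oplus> r \<otimes> x"] eq[of x] eq[of "f a"] x r
    by (simp add: l_distr m_assoc)
qed

text \<open>By linearity in column \<open>q\<close>, the determinant changes by \<open>r\<close>
  times that of a matrix with two equal columns.\<close>

lemma ring_det_add_column:
  assumes A: "A \<in> {..k} \<rightarrow> ({..k} \<rightarrow> carrier R)"
    and pq: "p \<le> k" "q \<le> k" "p \<noteq> q" and r: "r \<in> carrier R"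
    and B: "\<And>i j. i \<le> k \<Longrightarrow> j \<le> k \<Longrightarrow>
      B i j = (if j = q then A i q \<oplus> r \<otimes> A i p else A i j)"
  shows "ring_det R k B = ring_det R k A"
proof -
  let ?P = "{s. s permutes {..k}}"
  let ?sg = "\<lambda>s. if evenperm s then \<one> else \<ominus> \<one>"
  \<comment> \<open>Column \<open>q\<close> is overwritten by a copy of column \<open>p\<close>;
    this is the matrix whose determinant vanishes.\<close>
  define C where "C i = (A i)(q := A i p)" for i
  have Acl: "A i j \<in> carrier R" if "i \<le> k" "j \<le> k" for i j
    using A that by auto
  have Ccl: "C \<in> {..k} \<rightarrow> ({..k} \<rightarrow> carrier R)"
    unfolding C_def using Acl pq by auto
  have Bcl: "B \<in> {..k} \<rightarrow> ({..k} \<rightarrow> carrier R)"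
    using B Acl pq r by auto
  have cl: "(\<Otimes>i\<in>{..k}. M i (s i)) \<in> carrier R"
    if "s \<in> ?P" "M \<in> {..k} \<rightarrow> ({..k} \<rightarrow> carrier R)" for M s
    using that by (simp add: permuted_entries_closed)
  have split: "(\<Otimes>i\<in>{..k}. B i (s i)) =
      (\<Otimes>i\<in>{..k}. A i (s i)) \<oplus> r \<otimes> (\<Otimes>i\<in>{..k}. C i (s i))" if "s \<in> ?P" for s
  proof -
    have s: "s permutes {..k}" using that by simp
    \<comment> \<open>A permutation meets column \<open>q\<close> in exactly one row
      \<open>a\<close>, so only one factor of its term is modified.\<close>
    have "q \<in> s ` {..k}" using permutes_image[OF s] pq by simp
    then obtain a where a: "a \<le> k" "s a = q" by auto
    have uniq: "s i = q \<longleftrightarrow> i = a" for i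
      using permutes_inj[OF s] a(2) by (metis injD)
    have sk: "s i \<le> k" if "i \<le> k" for i
      using permutes_in_image[OF s, of i] that by simp
    let ?f = "\<lambda>i. A i (s i)"
    have f: "?f \<in> {..k} \<rightarrow> carrier R" using Acl sk by auto
    have "(\<Otimes>i\<in>{..k}. B i (s i)) = finprod R (?f(a := ?f a \<oplus> r \<otimes> A a p)) {..k}"
      using f a(1) sk Acl pq r by (intro finprod_cong') (auto simp: B uniq a(2))
    also have "\<dots> = finprod R ?f {..k} \<oplus> r \<otimes> finprod R (?f(a := A a p)) {..k}"
      using f a Acl pq r by (intro finprod_update_add) auto
    also have "finprod R (?f(a := A a p)) {..k} = (\<Otimes>i\<in>{..k}. C i (s i))"
      using sk Acl pq by (intro finprod_cong') (auto simp: C_def uniq)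
    finally show ?thesis .
  qed
  have sg: "?sg s \<in> carrier R" for s by auto
  have "ring_det R k B = (\<Oplus>s\<in>?P. ?sg s \<otimes> (\<Otimes>i\<in>{..k}. A i (s i)) \<oplus>
      r \<otimes> (?sg s \<otimes> (\<Otimes>i\<in>{..k}. C i (s i))))"
    unfolding ring_det_signed[OF Bcl]
  proof (intro finsum_cong' refl funcsetI)
    fix s assume s: "s \<in> ?P"
    note [simp] = cl[OF s A] cl[OF s Ccl] r sg[of s]
    show "?sg s \<otimes> (\<Otimes>i\<in>{..k}. A i (s i)) \<oplus> r \<otimes> (?sg s \<otimes> (\<Otimes>i\<in>{..k}. C i (s i))) \<in> carrier R"
      by (intro a_closed m_closed) (simp_all del: if_split)
    show "?sg s \<otimes> (\<Otimes>i\<in>{..k}. B i (s i)) =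
        ?sg s \<otimes> (\<Otimes>i\<in>{..k}. A i (s i)) \<oplus> r \<otimes> (?sg s \<otimes> (\<Otimes>i\<in>{..k}. C i (s i)))"
      unfolding split[OF s] using sg[of s] by (simp add: r_distr m_lcomm del: if_split)
  qed
  also have "\<dots> = ring_det R k A \<oplus> (\<Oplus>s\<in>?P. r \<otimes> (?sg s \<otimes> (\<Otimes>i\<in>{..k}. C i (s i))))"
    unfolding ring_det_signed[OF A] using cl[OF _ A] cl[OF _ Ccl] r sg
    by (intro finsum_addf funcsetI m_closed) auto
  also have "(\<Oplus>s\<in>?P. r \<otimes> (?sg s \<otimes> (\<Otimes>i\<in>{..k}. C i (s i)))) = r \<otimes> ring_det R k C"
    unfolding ring_det_signed[OF Ccl] using cl[OF _ Ccl] r sg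
    by (intro finsum_rdistr[symmetric] funcsetI m_closed) (auto simp: finite_permutations)
  also have "ring_det R k C = \<zero>"
    using pq by (intro ring_det_equal_columns[OF Ccl pq]) (simp add: C_def)
  also have "ring_det R k A \<in> carrier R"
    unfolding ring_det_signed[OF A] using cl[OF _ A] sg by (intro finsum_closed funcsetI m_closed) auto
  then have "ring_det R k A \<oplus> r \<otimes> \<zero> = ring_det R k A" using r by simp
  finally show ?thesis .
qed

text \<open>A permutation other than the identity moves some index and so contributes a product with
  a zero off-diagonal factor.\<close>

lemma ring_det_identity:
  "ring_det R k (\<lambda>i\<in>{..k}. \<lambda>j\<in>{..k}. if i = j then \<one> else \<zero>) = \<one>"
proof -
  let ?P = "{s. s permutes {..k}}"
  let ?A = "\<lambda>i\<in>{..k}. \<lambda>j\<in>{..k}. if i = j then \<one> else \<zero>"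
  have "ring_det R k ?A = (\<Oplus>s\<in>?P. if id = s then \<one> else \<zero>)"
    unfolding ring_det_def
  proof (intro finsum_cong' refl funcsetI)
    fix s assume "s \<in> ?P"
    then have s: "s permutes {..k}" by simp
    have sk: "s i \<le> k" if "i \<le> k" for i
      using permutes_in_image[OF s, of i] that by simp
    show "(if evenperm s then \<Otimes>i\<in>{..k}. ?A i (s i) else \<ominus> (\<Otimes>i\<in>{..k}. ?A i (s i)))
        = (if id = s then \<one> else \<zero>)"
    proof (cases "id = s")
      case True
      have "(\<Otimes>i\<in>{..k}. ?A i (s i)) = (\<Otimes>i\<in>{..k}. \<one>)"
        using True by (intro finprod_cong') auto
      then show ?thesis using True by auto
    next
      case False
      then obtain a where a: "s a \<noteq> a" by fastforce
      then have ak: "a \<le> k" using s by (meson atMost_iff permutes_not_in)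
      have "(\<Otimes>i\<in>insert a ({..k} - {a}). ?A i (s i)) = 
          ?A a (s a) \<otimes> (\<Otimes>i\<in>{..k} - {a}. ?A i (s i))"
        using sk ak by (intro finprod_insert) auto
      also have "(\<Otimes>i\<in>{..k} - {a}. ?A i (s i)) \<in> carrier R"
        using sk by (intro finprod_closed) auto
      then have "?A a (s a) \<otimes> (\<Otimes>i\<in>{..k} - {a}. ?A i (s i)) = \<zero>"
        using a ak sk by simp
      finally have "(\<Otimes>i\<in>{..k}. ?A i (s i)) = \<zero>"
        using ak by (simp add: insert_absorb)
      then show ?thesis using False by auto
    qed
  qed auto
  also have "\<dots> = \<one>"
    using add.finprod_singleton[of id ?P "\<lambda>_. \<one>"]
    by (simp add: finite_permutations permutes_id)
  finally show ?thesis .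
qed

text \<open>Every Leibniz term contains one factor from row \<open>t\<close>, and an ideal absorbs
  the other factors.\<close>

lemma ring_det_in_ideal:
  assumes A: "A \<in> {..k} \<rightarrow> ({..k} \<rightarrow> carrier R)"
    and J: "ideal J R" and t: "t \<le> k" "\<And>j. j \<le> k \<Longrightarrow> A t j \<in> J"
  shows "ring_det R k A \<in> J"
proof -
  interpret J: ideal J R by fact
  have term_in: "(if evenperm s then \<Otimes>i\<in>{..k}. A i (s i) else \<ominus> (\<Otimes>i\<in>{..k}. A i (s i))) \<in> J"
    if "s permutes {..k}" for s
  proof -
    have sk: "s i \<le> k" if "i \<le> k" for i
      using permutes_in_image[OF \<open>s permutes {..k}\<close>, of i] that by simp
    have cl: "(\<lambda>i. A i (s i)) \<in> {..k} \<rightarrow> carrier R" using A sk by auto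
    have "(\<Otimes>i\<in>insert t ({..k} - {t}). A i (s i)) = A t (s t) \<otimes> (\<Otimes>i\<in>{..k} - {t}. A i (s i))"
      using cl t by (intro finprod_insert) auto
    also have "\<dots> \<in> J"
      using t sk cl by (intro J.I_r_closed finprod_closed) auto
    finally have "(\<Otimes>i\<in>{..k}. A i (s i)) \<in> J"
      using t by (simp add: insert_absorb)
    then show ?thesis by auto
  qed
  have sum_in: "finsum R f S \<in> J" if "finite S" "\<And>s. s \<in> S \<Longrightarrow> f s \<in> J"
    for f and S :: "(nat \<Rightarrow> nat) set"
    using that
  proof (induction S rule: finite_induct)
    case (insert x F)
    then show ?case by (subst finsum_insert) auto
  qed auto
  show ?thesis
    unfolding ring_det_def
  proof (rule sum_in)
    show "finite {p. p permutes {..k}}" by (simp add: finite_permutations)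
  qed (rule term_in, simp)
qed

section \<open>Unimodular tuples and rows of matrices of determinant 1\<close>

text \<open>Passes from the sum of ideals in \<open>GCD_tuples\<close> to one generated ideal, which
  is the form used by \<open>unital_set\<close> and hence by \<open>USC\<close>.\<close>

lemma finsum_principal_ideals:
  assumes "finite S" "a \<in> S \<rightarrow> carrier R"
  shows "(\<Oplus>\<^bsub>ideals_set R\<^esub>i\<in>S. PIdl (a i)) = Idl (a ` S)"
  using assms
proof (induction S rule: finite_induct)
  interpret M: abelian_monoid "ideals_set R"
    using ideals_set_is_semiring by (rule semiring.axioms(1))
  case empty
  have "Idl {} = {\<zero>}"
    using genideal_minimal[OF zeroideal, of "{}"] genideal_ideal[of "{}"]
    by (auto intro: additive_subgroup.zero_closed ideal.axioms(1))
  moreover have "\<zero>\<^bsub>ideals_set R\<^esub> = {\<zero>}" by (simp add: ideals_set_def)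
  ultimately show ?case by simp
next
  interpret M: abelian_monoid "ideals_set R"
    using ideals_set_is_semiring by (rule semiring.axioms(1))
  case (insert x F)
  have ax: "a x \<in> carrier R" and aF: "a ` F \<subseteq> carrier R" using insert.prems by auto
  have id1: "ideal (PIdl (a x)) R" and id2: "ideal (Idl (a ` F)) R"
    using ax aF by (auto intro: cgenideal_ideal genideal_ideal)
  have "(\<Oplus>\<^bsub>ideals_set R\<^esub>i\<in>insert x F. PIdl (a i))
      = PIdl (a x) <+> (\<Oplus>\<^bsub>ideals_set R\<^esub>i\<in>F. PIdl (a i))"
    using insert.hyps insert.prems
    by (subst M.finsum_insert) (auto simp: ideals_set_def intro: cgenideal_ideal)
  also have "\<dots> = PIdl (a x) <+> Idl (a ` F)"
    using insert by simp
  also have "\<dots> = Idl (PIdl (a x) \<union> Idl (a ` F))"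
    using union_genideal[OF id1 id2] by simp
  also have "\<dots> = Idl (a ` insert x F)"
  proof (rule subset_antisym)
    have cl: "a ` insert x F \<subseteq> carrier R" using ax aF by auto
    note self = genideal_self[OF cl] and idl = genideal_ideal[OF cl]
    show "Idl (PIdl (a x) \<union> Idl (a ` F)) \<subseteq> Idl (a ` insert x F)"
      using self by (intro genideal_minimal[OF idl] Un_least cgenideal_minimal[OF idl]) auto
    have cl2: "PIdl (a x) \<union> Idl (a ` F) \<subseteq> carrier R"
      using id1 id2 by (meson Un_least additive_subgroup.a_subset ideal.axioms(1))
    show "Idl (a ` insert x F) \<subseteq> Idl (PIdl (a x) \<union> Idl (a ` F))"
      using genideal_self[OF cl2] cgenideal_self[OF ax] genideal_self[OF aF]
      by (intro genideal_minimal[OF genideal_ideal[OF cl2]]) auto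
  qed
  finally show ?case .
qed

lemma GCD_tuples_iff:
  "b \<in> GCD_tuples R k \<longleftrightarrow> b \<in> {..k} \<rightarrow>\<^sub>E carrier R \<and> Idl (b ` {..k}) = carrier R"
  unfolding GCD_tuples_def using finsum_principal_ideals[of "{..k}" b] by (auto simp: PiE_def)

text \<open>The ideal generated by the entries of a row contains the determinant, which is 1. Thus
  \<open>row_map\<close> takes values in the product of the spaces.\<close>

lemma SL_mats_rows_unimodular:
  assumes A: "A \<in> SL_mats R k" and t: "t \<le> k"
  shows "A t \<in> GCD_tuples R k"
proof -
  have cl: "A \<in> {..k} \<rightarrow> ({..k} \<rightarrow> carrier R)" and det: "ring_det R k A = \<one>"
    and row: "A t \<in> {..k} \<rightarrow>\<^sub>E carrier R"
    using A t by (auto simp: SL_mats_def PiE_def)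
  have sub: "A t ` {..k} \<subseteq> carrier R" using row by auto
  have "ring_det R k A \<in> Idl (A t ` {..k})"
    using genideal_self[OF sub] by (intro ring_det_in_ideal[OF cl genideal_ideal[OF sub] t]) auto
  then have "Idl (A t ` {..k}) = carrier R"
    using det ideal.one_imp_carrier[OF genideal_ideal[OF sub]] by simp
  then show ?thesis using row by (simp add: GCD_tuples_iff)
qed

section \<open>Units and classes modulo an ideal\<close>

text \<open>Lifts an inverse in the quotient to a representative in the ring, where it can serve as
  a coefficient of a column operation.\<close>

lemma unit_mod_inverse:
  assumes J: "ideal J R" and u: "u \<in> carrier R" and unit: "unit_mod R J u"
  obtains v where "v \<in> carrier R" "u \<otimes> v \<ominus> \<one> \<in> J"
proof -
  interpret J: ideal J R by fact
  obtain Y where Y: "Y \<in> carrier (R Quot J)" "(J +> u) \<otimes>\<^bsub>R Quot J\<^esub> Y = \<one>\<^bsub>R Quot J\<^esub>"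
    using unit unfolding unit_mod_def Units_def by blast
  obtain v where v: "v \<in> carrier R" "Y = J +> v"
    using Y(1) by (auto simp: FactRing_def A_RCOSETS_def')
  have "J +> (u \<otimes> v) = J +> \<one>"
    using Y(2) ring_hom_mult[OF J.rcos_ring_hom u v(1)] ring_hom_one[OF J.rcos_ring_hom] v(2)
    by simp
  then have "u \<otimes> v \<ominus> \<one> \<in> J"
    using quotient_eq_iff_same_a_r_cos[OF J] u v(1) by simp
  with v(1) show thesis by (rule that)
qed

text \<open>Apart from being unimodular, the first tuple enters \<open>PF_rel\<close> only through
  differences tested for membership in \<open>J\<close>. Such a test is insensitive to changes by
  elements of \<open>J\<close>, so the same scalar serves \<open>a\<close> and
  \<open>b\<close>.\<close>

lemma PF_class_cong:
  assumes J: "ideal J R" and ab: "a \<in> GCD_tuples R k" "b \<in> GCD_tuples R k"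
    and cong: "\<And>j. j \<le> k \<Longrightarrow> a j \<ominus> b j \<in> J"
  shows "PF_class R k m J a = PF_class R k m J b"
proof -
  interpret J: ideal J R by fact
  have cl: "a j \<in> carrier R" "b j \<in> carrier R" if "j \<le> k" for j
    using ab that by (auto simp: GCD_tuples_iff)
  have "a j \<ominus> x \<in> J \<longleftrightarrow> b j \<ominus> x \<in> J" if "j \<le> k" "x \<in> carrier R" for j x
  proof
    note [simp] = cl[OF that(1)] that(2)
    assume "b j \<ominus> x \<in> J"
    then have "(a j \<ominus> b j) \<oplus> (b j \<ominus> x) \<in> J" using cong[OF that(1)] by simp
    also have "(a j \<ominus> b j) \<oplus> (b j \<ominus> x) = a j \<ominus> x" using cl[OF that(1)] that(2) by algebra
    finally show "a j \<ominus> x \<in> J" .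
  next
    assume "a j \<ominus> x \<in> J"
    then have "(a j \<ominus> x) \<oplus> \<ominus> (a j \<ominus> b j) \<in> J" using cong[OF that(1)] by simp
    also have "(a j \<ominus> x) \<oplus> \<ominus> (a j \<ominus> b j) = b j \<ominus> x" using cl[OF that(1)] that(2) by algebra
    finally show "b j \<ominus> x \<in> J" .
  qed
  then have "(a, c) \<in> PF_rel R k m J \<longleftrightarrow> (b, c) \<in> PF_rel R k m J" for c
    using ab by (auto simp: PF_rel_def GCD_tuples_iff[of c] PiE_def Pi_iff)
  then show ?thesis by (auto simp: PF_class_def)
qed

section \<open>The Chinese remainder element\<close>

text \<open>For each ideal write 1 as an element of \<open>J\<close> plus an element
  \<open>y\<close> of that ideal; the product of all these \<open>y\<close> is the required
  \<open>c\<close>. Since \<open>c\<close> and \<open>c \<ominus> \<one>\<close> lie in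
  complementary ideals, \<open>c\<close> is idempotent modulo their intersection.\<close>

lemma comaximal_idempotent:
  assumes "finite S" and J: "ideal J R" and I: "\<And>i. i \<in> S \<Longrightarrow> ideal (I i) R"
    and com: "\<And>i. i \<in> S \<Longrightarrow> J <+> I i = carrier R"
  obtains c where "c \<in> carrier R" "c \<ominus> \<one> \<in> J" "\<And>i. i \<in> S \<Longrightarrow> c \<in> I i"
proof -
  interpret J: ideal J R by fact
  have "\<exists>c\<in>carrier R. c \<ominus> \<one> \<in> J \<and> (\<forall>i\<in>S. c \<in> I i)"
    using assms(1) I com
  proof (induction S rule: finite_induct)
    case empty
    show ?case by (intro bexI[of _ \<one>]) (auto simp: a_minus_def r_neg)
  next
    case (insert x F)
    then obtain c where c: "c \<in> carrier R" "c \<ominus> \<one> \<in> J" "\<And>i. i \<in> F \<Longrightarrow> c \<in> I i"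
      by auto
    interpret Ix: ideal "I x" R using insert.prems by auto
    have "\<one> \<in> J <+> I x" using insert.prems by auto
    then obtain u y where uy: "u \<in> J" "y \<in> I x" "\<one> = u \<oplus> y"
      unfolding set_add_def' by auto
    have ucl: "u \<in> carrier R" and ycl: "y \<in> carrier R"
      using uy by (auto dest: J.a_Hcarr Ix.a_Hcarr)
    have "(c \<ominus> \<one>) \<otimes> y \<ominus> u \<in> J"
      using c uy ycl by (simp add: a_minus_def J.I_r_closed)
    also have "(c \<ominus> \<one>) \<otimes> y \<ominus> u = c \<otimes> y \<ominus> (u \<oplus> y)"
      using c ucl ycl by algebra
    finally have "c \<otimes> y \<ominus> \<one> \<in> J" using uy by simp
    moreover have "c \<otimes> y \<in> I i" if "i \<in> insert x F" for i
      using that c uy ycl insert.prems(1)[OF that]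
      by (auto intro: ideal.I_r_closed ideal.I_l_closed)
    ultimately show ?case using c ycl by blast
  qed
  then show thesis using that by blast
qed

section \<open>Elementary operations leading from a unit vector to a given row\<close>

text \<open>The predicate \<open>P\<close> stands for reachability of a row up to congruence modulo
  \<open>J\<close>. Keeping it abstract separates the computation with one row from the effect of
  column operations on a whole matrix.\<close>

lemma unimodular_row_induct:
  fixes k :: nat
  assumes J: "ideal J R" and b: "b \<in> {..k} \<rightarrow> carrier R"
    and st: "s \<le> k" "t \<le> k" "s \<noteq> t"
    and z: "z \<in> Idl (b ` ({..k} - {s}))"
    and v: "v \<in> carrier R" "(b s \<oplus> z) \<otimes> v \<ominus> \<one> \<in> J"
    and unit_vector: "P (\<lambda>j. if j = t then \<one> else \<zero>)"
    and cong: "\<And>x y. P x \<Longrightarrow> x \<in> {..k} \<rightarrow> carrier R \<Longrightarrow> y \<in> {..k} \<rightarrow> carrier R \<Longrightarrow>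
      (\<And>j. j \<le> k \<Longrightarrow> x j \<ominus> y j \<in> J) \<Longrightarrow> P y"
    and step: "\<And>x p q r. P x \<Longrightarrow> x \<in> {..k} \<rightarrow> carrier R \<Longrightarrow> p \<le> k \<Longrightarrow> q \<le> k \<Longrightarrow> p \<noteq> q \<Longrightarrow>
      r \<in> carrier R \<Longrightarrow> P (x(q := x q \<oplus> r \<otimes> x p))"
  shows "P b"
proof -
  interpret J: ideal J R by fact
  have sub: "b ` ({..k} - {s}) \<subseteq> carrier R" using b by auto
  interpret Z: ideal "Idl (b ` ({..k} - {s}))" R by (rule genideal_ideal[OF sub])
  have zcl: "z \<in> carrier R" using z by (rule Z.a_Hcarr)
  have bcl: "b j \<in> carrier R" if "j \<le> k" for j using b that by auto
  \<comment> \<open>The intermediate row: \<open>b\<close> with entry \<open>s\<close> made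
    invertible modulo \<open>J\<close>, with inverse \<open>v\<close>.\<close>
  define y where "y = b(s := b s \<oplus> z)"
  have ycl: "y j \<in> carrier R" if "j \<le> k" for j
    unfolding y_def using bcl that zcl by (cases "j = s") auto
  \<comment> \<open>Entry \<open>t\<close> stays 1 during this phase, so each entry
    \<open>y j\<close> is produced by adding \<open>y j\<close> times entry
    \<open>t\<close>.\<close>
  have fill: "P (\<lambda>j. if j = t then \<one> else if j \<in> F then y j else \<zero>)"
    if "finite F" "F \<subseteq> {..k} - {t}" for F
    using that
  proof (induction F rule: finite_induct)
    case empty
    then show ?case using unit_vector by (simp cong: if_cong)
  next
    case (insert x F)
    let ?g = "\<lambda>j. if j = t then \<one> else if j \<in> F then y j else \<zero>"
    have "P (?g(x := ?g x \<oplus> y x \<otimes> ?g t))"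
      using insert st ycl by (intro step) auto
    also have "?g(x := ?g x \<oplus> y x \<otimes> ?g t)
        = (\<lambda>j. if j = t then \<one> else if j \<in> insert x F then y j else \<zero>)"
      using insert ycl by (auto simp: fun_eq_iff)
    finally show ?case .
  qed
  have "P y"
  proof -
    let ?g = "\<lambda>j. if j = t then \<one> else if j \<in> {..k} - {t} then y j else \<zero>"
    \<comment> \<open>Entry \<open>s\<close> is now \<open>b s \<oplus> z\<close>, so its product
      with \<open>?r\<close> is congruent to \<open>b t \<ominus> \<one>\<close>, the amount missing
      at entry \<open>t\<close>.\<close>
    let ?r = "v \<otimes> (b t \<ominus> \<one>)"
    have gcl: "?g \<in> {..k} \<rightarrow> carrier R" using ycl by auto
    have rcl: "?r \<in> carrier R" using v bcl st by simp
    have "P (?g(t := ?g t \<oplus> ?r \<otimes> ?g s))"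
      using st by (intro step gcl rcl fill) auto
    then show ?thesis
    proof (rule cong)
      show "?g(t := ?g t \<oplus> ?r \<otimes> ?g s) \<in> {..k} \<rightarrow> carrier R"
        using gcl rcl st ycl by auto
      show "y \<in> {..k} \<rightarrow> carrier R" using ycl by auto
      fix j assume j: "j \<le> k"
      show "(?g(t := ?g t \<oplus> ?r \<otimes> ?g s)) j \<ominus> y j \<in> J"
      proof (cases "j = t")
        case True
        have "((b s \<oplus> z) \<otimes> v \<ominus> \<one>) \<otimes> (b t \<ominus> \<one>) \<in> J"
          using v bcl st by (intro J.I_r_closed) auto
        also have "((b s \<oplus> z) \<otimes> v \<ominus> \<one>) \<otimes> (b t \<ominus> \<one>)
            = (\<one> \<oplus> v \<otimes> (b t \<ominus> \<one>) \<otimes> (b s \<oplus> z)) \<ominus> b t"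
          using v(1) bcl[OF st(1)] bcl[OF st(2)] zcl by algebra
        finally show ?thesis using True st by (simp add: y_def)
      next
        case False
        then show ?thesis using j ycl[OF j] by (simp add: a_minus_def r_neg)
      qed
    qed
  qed
  \<comment> \<open>The elements whose multiples may be added to entry \<open>s\<close> form an ideal containing the other
    entries, so this ideal contains \<open>z\<close> and no explicit linear combination is needed.\<close>
  let ?D = "{d \<in> carrier R. \<forall>r\<in>carrier R. \<forall>x\<in>{..k} \<rightarrow> carrier R.
      (\<forall>j\<le>k. j \<noteq> s \<longrightarrow> x j = b j) \<longrightarrow> P x \<longrightarrow> P (x(s := x s \<oplus> r \<otimes> d))}"
  have DI: "d \<in> ?D" if "d \<in> carrier R" "\<And>r x. r \<in> carrier R \<Longrightarrow> x \<in> {..k} \<rightarrow> carrier R \<Longrightarrow>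
      (\<And>j. j \<le> k \<Longrightarrow> j \<noteq> s \<Longrightarrow> x j = b j) \<Longrightarrow> P x \<Longrightarrow> P (x(s := x s \<oplus> r \<otimes> d))" for d
    using that by blast
  have DD: "P (x(s := x s \<oplus> r \<otimes> d))" if "d \<in> ?D" "r \<in> carrier R" "x \<in> {..k} \<rightarrow> carrier R"
    "\<And>j. j \<le> k \<Longrightarrow> j \<noteq> s \<Longrightarrow> x j = b j" "P x" for d r x
    using that by blast
  have scl: "x s \<in> carrier R" if "x \<in> {..k} \<rightarrow> carrier R" for x
    using that st by auto
  \<comment> \<open>The factor \<open>a\<close> is absorbed into the coefficient \<open>r\<close>,
    over which \<open>?D\<close> quantifies.\<close>
  have mult: "a \<otimes> d \<in> ?D" if "d \<in> ?D" "a \<in> carrier R" for a d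
  proof (rule DI)
    show "a \<otimes> d \<in> carrier R" using that by simp
    show "P (x(s := x s \<oplus> r \<otimes> (a \<otimes> d)))" if "r \<in> carrier R" "x \<in> {..k} \<rightarrow> carrier R"
      "\<And>j. j \<le> k \<Longrightarrow> j \<noteq> s \<Longrightarrow> x j = b j" "P x" for r x
      using DD[OF \<open>d \<in> ?D\<close>, of "r \<otimes> a" x] that \<open>a \<in> carrier R\<close> \<open>d \<in> ?D\<close> by (simp add: m_assoc)
  qed
  \<comment> \<open>The summands are added in succession. The intermediate row still agrees with
    \<open>b\<close> away from \<open>s\<close>, so the condition in \<open>?D\<close> applies to it
    again.\<close>
  have add: "d \<oplus> d' \<in> ?D" if "d \<in> ?D" "d' \<in> ?D" for d d'
  proof (rule DI)
    show "d \<oplus> d' \<in> carrier R" using that by simp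
    fix r x assume x: "r \<in> carrier R" "x \<in> {..k} \<rightarrow> carrier R"
      "\<And>j. j \<le> k \<Longrightarrow> j \<noteq> s \<Longrightarrow> x j = b j" "P x"
    let ?x = "x(s := x s \<oplus> r \<otimes> d)"
    have dcl: "d \<in> carrier R" "d' \<in> carrier R" using that by auto
    have xcl: "?x \<in> {..k} \<rightarrow> carrier R" using x(1,2) dcl scl[OF x(2)] by auto
    have "P (?x(s := ?x s \<oplus> r \<otimes> d'))"
      by (rule DD[OF that(2) x(1) xcl _ DD[OF that(1) x]]) (simp_all add: x(3))
    also have "?x(s := ?x s \<oplus> r \<otimes> d') = x(s := x s \<oplus> r \<otimes> (d \<oplus> d'))"
      using x dcl scl[OF x(2)] by (simp add: r_distr a_assoc)
    finally show "P (x(s := x s \<oplus> r \<otimes> (d \<oplus> d')))" .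
  qed
  have zero: "\<zero> \<in> ?D"
  proof (rule DI)
    show "P (x(s := x s \<oplus> r \<otimes> \<zero>))" if "r \<in> carrier R" "x \<in> {..k} \<rightarrow> carrier R" "P x" for r x
      using that scl by simp
  qed simp
  have neg: "\<ominus> d \<in> ?D" if "d \<in> ?D" for d
    using mult[OF that, of "\<ominus> \<one>"] that by (simp add: l_minus)
  have "ideal ?D R"
  proof (rule idealI[OF ring_axioms])
    show "subgroup ?D (add_monoid R)"
    proof (rule add.subgroupI)
      show "?D \<subseteq> carrier R" by blast
      show "?D \<noteq> {}" using zero by blast
      show "\<ominus> d \<in> ?D" if "d \<in> ?D" for d by (rule neg[OF that])
      show "d \<oplus> d' \<in> ?D" if "d \<in> ?D" "d' \<in> ?D" for d d' by (rule add[OF that])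
    qed
    show "a \<otimes> d \<in> ?D" if "d \<in> ?D" "a \<in> carrier R" for a d by (rule mult[OF that])
    show "d \<otimes> a \<in> ?D" if "d \<in> ?D" "a \<in> carrier R" for a d
      using mult[OF that] that m_comm[of a d] by simp
  qed
  \<comment> \<open>As \<open>x i\<close> equals \<open>b i\<close> here, adding a multiple of
    \<open>b i\<close> to entry \<open>s\<close> is a single elementary operation.\<close>
  moreover have "b ` ({..k} - {s}) \<subseteq> ?D"
  proof (rule image_subsetI, rule DI)
    fix i assume i: "i \<in> {..k} - {s}"
    show "b i \<in> carrier R" using bcl i by simp
    show "P (x(s := x s \<oplus> r \<otimes> b i))" if "r \<in> carrier R" "x \<in> {..k} \<rightarrow> carrier R"
      "\<And>j. j \<le> k \<Longrightarrow> j \<noteq> s \<Longrightarrow> x j = b j" "P x" for r x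
      using step[of x i s r] that i st by simp
  qed
  ultimately have "z \<in> ?D" by (rule genideal_minimal[THEN subsetD, OF _ _ z])
  then have "P (y(s := y s \<oplus> \<ominus> \<one> \<otimes> z))"
    by (rule DD[OF _ _ _ _ \<open>P y\<close>]) (use ycl in \<open>auto simp: y_def\<close>)
  also have "y(s := y s \<oplus> \<ominus> \<one> \<otimes> z) = b"
    using bcl[OF st(1)] zcl by (simp add: y_def l_minus a_assoc r_neg)
  finally show ?thesis .
qed

section \<open>Changing one row of a matrix modulo its ideal while preserving the others modulo
  theirs\<close>

lemma SL_mats_replace_row:
  assumes I: "\<And>i. i \<le> k \<Longrightarrow> ideal (I i) R" and t: "t \<le> k"
    and c: "c \<in> carrier R" "c \<ominus> \<one> \<in> I t" "\<And>i. i \<le> k \<Longrightarrow> i \<noteq> t \<Longrightarrow> c \<in> I i"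
    and b: "b \<in> {..k} \<rightarrow> carrier R" and s: "s \<le> k" "s \<noteq> t"
    and z: "z \<in> Idl (b ` ({..k} - {s}))"
    and v: "v \<in> carrier R" "(b s \<oplus> z) \<otimes> v \<ominus> \<one> \<in> I t"
    and A: "A \<in> SL_mats R k" "\<And>j. j \<le> k \<Longrightarrow> A t j \<ominus> (if j = t then \<one> else \<zero>) \<in> I t"
  obtains B where "B \<in> SL_mats R k" "\<And>j. j \<le> k \<Longrightarrow> B t j \<ominus> b j \<in> I t"
    "\<And>i j. i \<le> k \<Longrightarrow> j \<le> k \<Longrightarrow> i \<noteq> t \<Longrightarrow> B i j \<ominus> A i j \<in> I i"
proof -
  interpret J: ideal "I t" R using I t by simp
  have entry: "M i j \<in> carrier R" if "M \<in> SL_mats R k" "i \<le> k" "j \<le> k" for M i j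
    using that by (auto simp: SL_mats_def PiE_def Pi_iff)
  \<comment> \<open>Reachability of \<open>y\<close> now means that it is realised modulo
    \<open>I t\<close> as row \<open>t\<close> of some matrix of determinant 1 whose other rows have
    kept their residues.\<close>
  define P where "P y \<longleftrightarrow> (\<exists>B\<in>SL_mats R k. (\<forall>j\<le>k. B t j \<ominus> y j \<in> I t) \<and>
      (\<forall>i\<le>k. \<forall>j\<le>k. i \<noteq> t \<longrightarrow> B i j \<ominus> A i j \<in> I i))" for y
  have "P b"
  proof (rule unimodular_row_induct[OF J.is_ideal b s(1) t s(2) z v])
    have "A i j \<ominus> A i j \<in> I i" if "i \<le> k" "j \<le> k" for i j
      using entry[OF A(1) that] additive_subgroup.zero_closed[OF ideal.axioms(1)[OF I[OF that(1)]]]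
      by (simp add: a_minus_def r_neg)
    then show "P (\<lambda>j. if j = t then \<one> else \<zero>)"
      unfolding P_def using A by blast
  next
    fix x y assume "P x" and x: "x \<in> {..k} \<rightarrow> carrier R" and y: "y \<in> {..k} \<rightarrow> carrier R"
      and xy: "\<And>j. j \<le> k \<Longrightarrow> x j \<ominus> y j \<in> I t"
    then obtain B where B: "B \<in> SL_mats R k" "\<And>j. j \<le> k \<Longrightarrow> B t j \<ominus> x j \<in> I t"
      "\<And>i j. i \<le> k \<Longrightarrow> j \<le> k \<Longrightarrow> i \<noteq> t \<Longrightarrow> B i j \<ominus> A i j \<in> I i"
      unfolding P_def by blast
    have "B t j \<ominus> y j \<in> I t" if j: "j \<le> k" for j
    proof -
      have "(B t j \<ominus> x j) \<oplus> (x j \<ominus> y j) \<in> I t" using B(2) xy j by simp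
      also have "x j \<in> carrier R" "y j \<in> carrier R" using x y j by auto
      then have "(B t j \<ominus> x j) \<oplus> (x j \<ominus> y j) = B t j \<ominus> y j"
        using entry[OF B(1) t j] by algebra
      finally show ?thesis .
    qed
    then show "P y" unfolding P_def using B(1,3) by blast
  next
    fix x p q r assume "P x" and x: "x \<in> {..k} \<rightarrow> carrier R"
      and pq: "p \<le> k" "q \<le> k" "p \<noteq> q" and r: "r \<in> carrier R"
    then obtain B where B: "B \<in> SL_mats R k" "\<And>j. j \<le> k \<Longrightarrow> B t j \<ominus> x j \<in> I t"
      "\<And>i j. i \<le> k \<Longrightarrow> j \<le> k \<Longrightarrow> i \<noteq> t \<Longrightarrow> B i j \<ominus> A i j \<in> I i"
      unfolding P_def by blast
    \<comment> \<open>The coefficient \<open>c \<otimes> r\<close> is congruent to \<open>r\<close>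
      modulo \<open>I t\<close> and to zero modulo every other \<open>I i\<close>.\<close>
    define C where "C = (\<lambda>i\<in>{..k}. \<lambda>j\<in>{..k}.
      if j = q then B i q \<oplus> (c \<otimes> r) \<otimes> B i p else B i j)"
    have "ring_det R k C = ring_det R k B"
      using B(1) pq r c(1)
      by (intro ring_det_add_column[where p = p and q = q and r = "c \<otimes> r"])
        (auto simp: C_def SL_mats_def PiE_def)
    then have C: "C \<in> SL_mats R k"
      using B(1) pq r c(1) entry[OF B(1)] by (auto simp: C_def SL_mats_def)
    have "C t j \<ominus> (x(q := x q \<oplus> r \<otimes> x p)) j \<in> I t" if j: "j \<le> k" for j
    proof (cases "j = q")
      case True
      have cl: "x p \<in> carrier R" "x q \<in> carrier R" using x pq by auto
      \<comment> \<open>The error splits into the old errors in columns \<open>q\<close> and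
        \<open>p\<close> and the deviation of \<open>c\<close> from 1.\<close>
      have "(B t q \<ominus> x q) \<oplus> ((c \<otimes> r) \<otimes> (B t p \<ominus> x p) \<oplus> (c \<ominus> \<one>) \<otimes> (r \<otimes> x p)) \<in> I t"
        using B(2) pq c r cl by (intro J.a_closed J.I_l_closed J.I_r_closed) auto
      also have "(B t q \<ominus> x q) \<oplus> ((c \<otimes> r) \<otimes> (B t p \<ominus> x p) \<oplus> (c \<ominus> \<one>) \<otimes> (r \<otimes> x p))
          = (B t q \<oplus> (c \<otimes> r) \<otimes> B t p) \<ominus> (x q \<oplus> r \<otimes> x p)"
        using entry[OF B(1) t pq(1)] entry[OF B(1) t pq(2)] c(1) r cl by algebra
      finally show ?thesis using True t pq by (simp add: C_def)
    next
      case False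
      then show ?thesis using B(2) j t by (simp add: C_def)
    qed
    moreover have "C i j \<ominus> A i j \<in> I i" if i: "i \<le> k" "j \<le> k" "i \<noteq> t" for i j
    proof (cases "j = q")
      case True
      interpret Ii: ideal "I i" R using I i by simp
      note cl = entry[OF B(1) i(1) pq(1)] entry[OF B(1) i(1) pq(2)] entry[OF A(1) i(1) pq(2)]
      have "(B i q \<ominus> A i q) \<oplus> c \<otimes> (r \<otimes> B i p) \<in> I i"
        using B(3) pq c(3) i r cl by (intro Ii.a_closed Ii.I_r_closed) auto
      also have "(B i q \<ominus> A i q) \<oplus> c \<otimes> (r \<otimes> B i p) = (B i q \<oplus> (c \<otimes> r) \<otimes> B i p) \<ominus> A i q"
        using cl c(1) r by algebra
      finally show ?thesis using True i by (simp add: C_def)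
    next
      case False
      then show ?thesis using B(3) i by (simp add: C_def)
    qed
    ultimately show "P (x(q := x q \<oplus> r \<otimes> x p))"
      unfolding P_def using C by blast
  qed
  then show thesis unfolding P_def using that by blast
qed

section \<open>The unital set condition for the entries of a unimodular tuple\<close>

lemma USC_unimodular:
  assumes J: "USC R J \<or> J = carrier R" and k: "1 \<le> k"
    and b: "b \<in> GCD_tuples R k" and s: "s \<le> k"
  obtains z v where "z \<in> Idl (b ` ({..k} - {s}))" "v \<in> carrier R" "(b s \<oplus> z) \<otimes> v \<ominus> \<one> \<in> J"
proof -
  have bcl: "b j \<in> carrier R" if "j \<le> k" for j
    using b that by (auto simp: GCD_tuples_iff)
  have sub: "b ` ({..k} - {s}) \<subseteq> carrier R" using bcl by auto
  note idl = genideal_ideal[OF sub]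
  from J show thesis
  proof
    assume usc: "USC R J"
    \<comment> \<open>\<open>USC\<close> counts from 1 and singles out the first element, while
      \<open>b\<close> is indexed from 0. The transposition puts entry \<open>s\<close> first, and
      \<open>k + 1\<close> elements suffice for \<open>USC\<close> because \<open>k\<close> is at
      least 1.\<close>
    define a where "a i = b (transpose 0 s (i - 1))" for i
    have shift: "a ` {Suc l..k + 1} = b ` (transpose 0 s ` {l..k})" for l
    proof -
      have "a ` Suc ` {l..k} = b ` transpose 0 s ` {l..k}"
        unfolding image_image by (simp add: a_def)
      then show ?thesis by simp
    qed
    have "transpose 0 s ` {0..k} = {..k}"
      using s permutes_image[OF permutes_swap_id[of 0 "{..k}" s]] by (simp add: atMost_atLeast0)
    with shift[of 0] have all: "a ` {1..k + 1} = b ` {..k}" by simp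
    have "transpose 0 s ` {1..k} = transpose 0 s ` ({0..k} - {0})"
      by (intro arg_cong[where f = "image _"]) auto
    also have "\<dots> = {..k} - {s}"
      using \<open>transpose 0 s ` {0..k} = {..k}\<close>
      by (subst image_set_diff) (auto simp: inj_transpose)
    finally have "a ` {2..k + 1} = b ` ({..k} - {s})"
      using shift[of 1] by (simp add: numeral_2_eq_2)
    moreover have "unital_set R (a ` {1..k + 1})"
      unfolding all unital_set_def using b bcl by (auto simp: GCD_tuples_iff)
    ultimately obtain z where z: "z \<in> Idl (b ` ({..k} - {s}))" "unit_mod R J (a 1 \<oplus> z)"
      using usc k unfolding USC_def by (metis Suc_1 Suc_eq_plus1 Suc_le_mono)
    have "b s \<oplus> z \<in> carrier R"
      using bcl[OF s] z(1) additive_subgroup.a_Hcarr[OF ideal.axioms(1)[OF idl]] by simp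
    then obtain v where "v \<in> carrier R" "(b s \<oplus> z) \<otimes> v \<ominus> \<one> \<in> J"
      using usc z(2) unit_mod_inverse[of J "b s \<oplus> z"] unfolding USC_def a_def by auto
    with z(1) show thesis by (rule that)
  next
    assume "J = carrier R"
    \<comment> \<open>Modulo the whole ring every congruence holds, so any choice of
      \<open>z\<close> and \<open>v\<close> in their ideals will do.\<close>
    then show thesis
      using that[of \<zero> \<one>] bcl[OF s] additive_subgroup.zero_closed[OF ideal.axioms(1)[OF idl]]
      by simp
  qed
qed

end

section \<open>Surjectivity, treating the rows one after the other\<close>

theorem mainTheorem3:
  fixes R :: "('a, 'b) ring_scheme"
    and k :: nat
    and I :: "nat \<Rightarrow> 'a set"
    and m :: "nat \<Rightarrow> nat \<Rightarrow> nat"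
  assumes "cring R"
    and "1 \<le> k"
    and "\<And>i. i \<le> k \<Longrightarrow> ideal (I i) R"
    and "\<And>i j. i \<le> k \<Longrightarrow> j \<le> k \<Longrightarrow> i \<noteq> j \<Longrightarrow> I i <+>\<^bsub>R\<^esub> I j = carrier R"
    and "USC R (\<Otimes>\<^bsub>ideals_set R\<^esub>i\<in>{..k}. I i) \<or>
         (\<Otimes>\<^bsub>ideals_set R\<^esub>i\<in>{..k}. I i) = carrier R"
    and "\<And>i j. i \<le> k \<Longrightarrow> j \<le> k \<Longrightarrow> 1 \<le> m i j"
  shows "row_map R k m I ` SL_mats R k = (\<Pi>\<^sub>E i\<in>{..k}. PF_space R k (m i) (I i))"
proof
  interpret cring R by fact
  show "row_map R k m I ` SL_mats R k \<subseteq> (\<Pi>\<^sub>E i\<in>{..k}. PF_space R k (m i) (I i))"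
    unfolding row_map_def PF_space_def PF_class_def
    by (intro image_subsetI restrict_PiE_iff[THEN iffD2] ballI quotientI
        SL_mats_rows_unimodular) auto
  show "(\<Pi>\<^sub>E i\<in>{..k}. PF_space R k (m i) (I i)) \<subseteq> row_map R k m I ` SL_mats R k"
  proof
    fix f assume f: "f \<in> (\<Pi>\<^sub>E i\<in>{..k}. PF_space R k (m i) (I i))"
    then have "\<forall>i\<in>{..k}. \<exists>b\<in>GCD_tuples R k. f i = PF_class R k (m i) (I i) b"
      by (auto simp: PF_space_def PF_class_def PiE_def Pi_iff elim!: quotientE)
    then obtain b where b: "\<And>i. i \<le> k \<Longrightarrow> b i \<in> GCD_tuples R k"
      "\<And>i. i \<le> k \<Longrightarrow> f i = PF_class R k (m i) (I i) (b i)"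
      by (metis atMost_iff)
    \<comment> \<open>For co-maximal ideals the product is the intersection. An inverse modulo the
      product is therefore an inverse modulo each \<open>I t\<close>.\<close>
    have prod_le: "(\<Otimes>\<^bsub>ideals_set R\<^esub>i\<in>{..k}. I i) \<subseteq> I t" if "t \<le> k" for t
      using ideal_prod_eq_Inter[of I k] assms(3,4) that by auto
    \<comment> \<open>Invariant: rows below \<open>n\<close> have their target residues, and the
      remaining rows are still congruent to unit vectors.\<close>
    have "\<exists>A\<in>SL_mats R k. \<forall>i\<le>k. \<forall>j\<le>k.
        A i j \<ominus>\<^bsub>R\<^esub> (if i < n then b i j else if j = i then \<one>\<^bsub>R\<^esub> else \<zero>\<^bsub>R\<^esub>) \<in> I i" if "n \<le> Suc k" for n
      using that
    proof (induction n)
      case 0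
      let ?A = "\<lambda>i\<in>{..k}. \<lambda>j\<in>{..k}. if i = j then \<one>\<^bsub>R\<^esub> else \<zero>\<^bsub>R\<^esub>"
      have "?A \<in> SL_mats R k"
        using ring_det_identity by (auto simp: SL_mats_def)
      moreover have "?A i j \<ominus>\<^bsub>R\<^esub> (if j = i then \<one>\<^bsub>R\<^esub> else \<zero>\<^bsub>R\<^esub>) \<in> I i" if "i \<le> k" "j \<le> k" for i j
        using that additive_subgroup.zero_closed[OF ideal.axioms(1)[OF assms(3)]]
        by (auto simp: a_minus_def r_neg)
      ultimately show ?case by (intro bexI[of _ ?A]) auto
    next
      case (Suc n)
      then obtain A where A: "A \<in> SL_mats R k" "\<And>i j. i \<le> k \<Longrightarrow> j \<le> k \<Longrightarrow>
          A i j \<ominus>\<^bsub>R\<^esub> (if i < n then b i j else if j = i then \<one>\<^bsub>R\<^esub> else \<zero>\<^bsub>R\<^esub>) \<in> I i"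
        by auto
      have n: "n \<le> k" using Suc.prems by simp
      \<comment> \<open>Since \<open>k\<close> is at least 1, one of the indices 0 and 1 differs
        from \<open>n\<close>.\<close>
      obtain s where s: "s \<le> k" "s \<noteq> n"
        using assms(2) by (metis le0 zero_neq_one)
      obtain c where c: "c \<in> carrier R" "c \<ominus>\<^bsub>R\<^esub> \<one>\<^bsub>R\<^esub> \<in> I n" "\<And>i. i \<in> {..k} - {n} \<Longrightarrow> c \<in> I i"
        using comaximal_idempotent[of "{..k} - {n}" "I n" I] assms(3,4) n by auto
      obtain z v where zv: "z \<in> Idl\<^bsub>R\<^esub> (b n ` ({..k} - {s}))" "v \<in> carrier R"
        "(b n s \<oplus>\<^bsub>R\<^esub> z) \<otimes>\<^bsub>R\<^esub> v \<ominus>\<^bsub>R\<^esub> \<one>\<^bsub>R\<^esub> \<in> I n"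
        using USC_unimodular[OF assms(5,2) b(1)[OF n] s(1)] prod_le[OF n] by blast
      have bn: "b n \<in> {..k} \<rightarrow> carrier R"
        using b(1)[OF n] by (auto simp: GCD_tuples_iff)
      have An: "A n j \<ominus>\<^bsub>R\<^esub> (if j = n then \<one>\<^bsub>R\<^esub> else \<zero>\<^bsub>R\<^esub>) \<in> I n" if "j \<le> k" for j
        using A(2)[OF n that] by simp
      obtain B where B: "B \<in> SL_mats R k" "\<And>j. j \<le> k \<Longrightarrow> B n j \<ominus>\<^bsub>R\<^esub> b n j \<in> I n"
        "\<And>i j. i \<le> k \<Longrightarrow> j \<le> k \<Longrightarrow> i \<noteq> n \<Longrightarrow> B i j \<ominus>\<^bsub>R\<^esub> A i j \<in> I i"
        using SL_mats_replace_row[of k I, OF assms(3) n c(1,2) _ bn s zv A(1) An] c(3)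
        by auto
      have "B i j \<ominus>\<^bsub>R\<^esub> (if i < Suc n then b i j else if j = i then \<one>\<^bsub>R\<^esub> else \<zero>\<^bsub>R\<^esub>) \<in> I i"
        if ij: "i \<le> k" "j \<le> k" for i j
      proof (cases "i = n")
        case True
        then show ?thesis using B(2) ij by simp
      next
        case False
        let ?x = "if i < n then b i j else if j = i then \<one>\<^bsub>R\<^esub> else \<zero>\<^bsub>R\<^esub>"
        interpret Ii: ideal "I i" R using assms(3) ij by simp
        have cl: "A i j \<in> carrier R" "B i j \<in> carrier R" "?x \<in> carrier R"
          using A(1) B(1) b(1)[OF ij(1)] ij
          by (auto simp: SL_mats_def PiE_def Pi_iff GCD_tuples_iff)
        have "(B i j \<ominus>\<^bsub>R\<^esub> A i j) \<oplus>\<^bsub>R\<^esub> (A i j \<ominus>\<^bsub>R\<^esub> ?x) \<in> I i"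
          using A(2)[OF ij] B(3)[OF ij False] by (rule Ii.a_closed[rotated])
        also have "(B i j \<ominus>\<^bsub>R\<^esub> A i j) \<oplus>\<^bsub>R\<^esub> (A i j \<ominus>\<^bsub>R\<^esub> ?x) = B i j \<ominus>\<^bsub>R\<^esub> ?x"
          using cl by algebra
        finally show ?thesis using False by (simp add: less_Suc_eq)
      qed
      then show ?case using B(1) by blast
    qed
    from this[of "Suc k"] obtain A where A: "A \<in> SL_mats R k"
      "\<And>i j. i \<le> k \<Longrightarrow> j \<le> k \<Longrightarrow> A i j \<ominus>\<^bsub>R\<^esub> b i j \<in> I i"
      by (auto simp: less_Suc_eq_le)
    have "row_map R k m I A = f"
    proof
      fix i
      show "row_map R k m I A i = f i"
      proof (cases "i \<le> k")
        case True
        then show ?thesis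
          using PF_class_cong[OF assms(3) SL_mats_rows_unimodular[OF A(1)] b(1) A(2)] b(2)
          by (simp add: row_map_def)
      next
        \<comment> \<open>Outside the index range both functions are \<open>undefined\<close>, by
          extensionality.\<close>
        case False
        then show ?thesis using f by (auto simp: row_map_def PiE_def extensional_def)
      qed
    qed
    then show "f \<in> row_map R k m I ` SL_mats R k" using A(1) by blast
  qed
qed

end
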